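(* Let $n\ge2$ and let $F:2^{[n]}\to\mathbb R$ satisfy $F(\varnothing)=0$ and $F(\{i\})=0$ for all $i\in[n]$. Then $F\in\mathfrak G_n$ if and only if for each $H\subseteq[n]$ with $|H|\ge2$ there exists $c^H\in\mathcal C_n$ such that $$E_{c^H}(K)\ge F(K)\quad\text{for all }K\subseteq[n]\text{ with }|K|\ge2,\qquad E_{c^H}(H)=F(H).$$ In particular, $\mathfrak G_n$ is a bounded rational polytope.
   Context: $[n]=\{1,\ldots,n\}$. A finite-dimensional GPT state space is a nonempty compact convex subset $K$ of some $\mathbb R^d$, $d\ge1$. A (finite-outcome) measurement on $K$ is a finite family $(e_x)_{x\in X}$ of nonnegative affine functions on $K$ with $\sum_{x}e_x=1$; every such family is allowed. For a list of (not necessarily distinct) states $s_1,\ldots,s_n\in K$ and nonempty $H\subseteq[n]$, $D(H)=\max\sum_{i\in H}e_i(s_i)$, the maximum over all measurements $(e_i)_{i\in H}$ indexed by $H$, and $F(H)=|H|-D(H)$; also $D(\varnothing)=F(\varnothing)=0$. $F$ is the error profile of the list; singletons always have $F(\{i\})=0$. The GPT profile region $\mathfrak G_n\subseteq\mathbb R^{2^n-n-1}$ is the set of all vectors $(F(H))_{H\subseteq[n],|H|\ge2}$ arising from error profiles of lists of $n$ states in all finite-dimensional GPT state spaces (no closure is taken). A function $F$ with $F(\varnothing)=F(\{i\})=0$ is identified with its vector of values at sets with $|H|\ge2$ when writing $F\in\mathfrak G_n$. The coefficient polytope is $\mathcal C_n=\{(c_B)_{\varnothing\ne B\subseteq[n]}: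 c_B\ge0,\ \sum_{B\ni i}c_B=1\text{ for all }i\in[n]\}$. For $c\in\mathcal C_n$ and $H\subseteq[n]$, $\theta_c(H)=\sum_{B:\,B\cap H\ne\varnothing}c_B$ and $E_c(H)=|H|-\theta_c(H)$. A rational polytope is a bounded polyhedron defined by finitely many linear inequalities with rational coefficients. *)

theory Defs
  imports "HOL-Analysis.Analysis"
begin

text \<open>
  The dimension \<open>d\<close> of a state space is existentially quantified in the definition of the profile
  region, so $\mathbb R^d$ is taken to be the library's \<^const>\<open>Euclidean_space\<close> \<open>d\<close>: the functions
  of type \<open>nat \<Rightarrow> real\<close> vanishing at all indices \<open>\<ge> d\<close>, with the product topology. Functions carry
  no \<open>real_vector\<close> instance, so convexity and affinity are spelled out by convex combinations.
\<close>

definition convex_comb :: "real \<Rightarrow> (nat \<Rightarrow> real) \<Rightarrow> (nat \<Rightarrow> real) \<Rightarrow> nat \<Rightarrow> real" where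
  "convex_comb t x y = (\<lambda>k. (1 - t) * x k + t * y k)"

definition state_space :: "nat \<Rightarrow> (nat \<Rightarrow> real) set \<Rightarrow> bool" where
  "state_space d K \<longleftrightarrow>
     K \<noteq> {} \<and> compactin (Euclidean_space d) K \<and>
     (\<forall>x\<in>K. \<forall>y\<in>K. \<forall>t\<in>{0..1}. convex_comb t x y \<in> K)"

definition affine_fun_on :: "(nat \<Rightarrow> real) set \<Rightarrow> ((nat \<Rightarrow> real) \<Rightarrow> real) \<Rightarrow> bool" where
  "affine_fun_on K f \<longleftrightarrow>
     (\<forall>x\<in>K. \<forall>y\<in>K. \<forall>t\<in>{0..1}. f (convex_comb t x y) = (1 - t) * f x + t * f y)"

definition measurement ::
    "(nat \<Rightarrow> real) set \<Rightarrow> 'x set \<Rightarrow> ('x \<Rightarrow> (nat \<Rightarrow> real) \<Rightarrow> real) \<Rightarrow> bool" where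
  "measurement K X e \<longleftrightarrow>
     finite X \<and>
     (\<forall>x\<in>X. affine_fun_on K (e x) \<and> (\<forall>s\<in>K. 0 \<le> e x s)) \<and>
     (\<forall>s\<in>K. (\<Sum>x\<in>X. e x s) = 1)"

text \<open>
  The maximum is attained: affine functions on a state space with values in \<open>[0,1]\<close> that are
  indexed by a finite set form a compact set for pointwise convergence.
\<close>

definition discrimination ::
    "(nat \<Rightarrow> real) set \<Rightarrow> (nat \<Rightarrow> nat \<Rightarrow> real) \<Rightarrow> nat set \<Rightarrow> real" where
  "discrimination K s H =
     (if H = {} then 0
      else (GREATEST v. \<exists>e. measurement K H e \<and> v = (\<Sum>i\<in>H. e i (s i))))"

definition error_profile ::
    "(nat \<Rightarrow> real) set \<Rightarrow> (nat \<Rightarrow> nat \<Rightarrow> real) \<Rightarrow> nat set \<Rightarrow> real" where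
  "error_profile K s H = real (card H) - discrimination K s H"

definition profile_index :: "nat \<Rightarrow> nat set set" where
  "profile_index n = {H. H \<subseteq> {1..n} \<and> 2 \<le> card H}"

text \<open>
  Real vectors with a finite coordinate set \<open>I\<close> are the elements of \<open>I \<rightarrow>\<^sub>E UNIV\<close>, that is,
  functions with value \<^const>\<open>undefined\<close> outside \<open>I\<close>; hence the use of \<^const>\<open>restrict\<close> below.
\<close>

definition gpt_region :: "nat \<Rightarrow> (nat set \<Rightarrow> real) set" where
  "gpt_region n =
     {restrict (error_profile K s) (profile_index n) | d K s.
        1 \<le> d \<and> state_space d K \<and> (\<forall>i\<in>{1..n}. s i \<in> K)}"

definition coefficient_polytope :: "nat \<Rightarrow> (nat set \<Rightarrow> real) set" where
  "coefficient_polytope n =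
     {c \<in> (Pow {1..n} - {{}}) \<rightarrow>\<^sub>E {0..}.
        \<forall>i\<in>{1..n}. (\<Sum>B | B \<subseteq> {1..n} \<and> i \<in> B. c B) = 1}"

definition theta :: "nat \<Rightarrow> (nat set \<Rightarrow> real) \<Rightarrow> nat set \<Rightarrow> real" where
  "theta n c H = (\<Sum>B | B \<subseteq> {1..n} \<and> B \<inter> H \<noteq> {}. c B)"

definition coeff_error :: "nat \<Rightarrow> (nat set \<Rightarrow> real) \<Rightarrow> nat set \<Rightarrow> real" where
  "coeff_error n c H = real (card H) - theta n c H"

definition bounded_rational_polytope :: "'i set \<Rightarrow> ('i \<Rightarrow> real) set \<Rightarrow> bool" where
  "bounded_rational_polytope I P \<longleftrightarrow>
     (\<exists>L :: (('i \<Rightarrow> rat) \<times> rat) set. finite L \<and>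
        P = {x \<in> I \<rightarrow>\<^sub>E UNIV. \<forall>(a, b)\<in>L. (\<Sum>i\<in>I. of_rat (a i) * x i) \<le> of_rat b}) \<and>
     (\<exists>M. \<forall>x\<in>P. \<forall>i\<in>I. \<bar>x i\<bar> \<le> M)"

end

theory Submission
  imports Defs
begin

text \<open>
  Necessity: an optimal measurement \<open>e\<close> for \<open>H\<close> turns each \<open>s\<^sub>i\<close> into the classical distribution
  \<open>x \<mapsto> e\<^sub>x(s\<^sub>i)\<close>. Cutting, for each \<open>x\<close>, the function \<open>i \<mapsto> e\<^sub>x(s\<^sub>i)\<close> into horizontal layers
  gives coefficients \<open>c\<close> for which \<open>\<theta>\<^sub>c(K)\<close> is the classical discrimination value
  \<open>\<Sum>\<^sub>x max {e\<^sub>x(s\<^sub>i) | i \<in> K}\<close>; it is at most \<open>D(K)\<close>, with equality at \<open>K = H\<close>.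

  Sufficiency: let the state space be a product of simplices, one factor for each \<open>H\<close>, and let the
  \<open>H\<close>-component of \<open>s\<^sub>i\<close> give weight \<open>c\<^sup>H(B)\<close> to every \<open>B\<close> containing \<open>i\<close>. Reading off one factor
  attains \<open>\<theta>\<close> of that factor, and weak duality shows that no measurement beats the best factor.

  The region is therefore a finite intersection of projections of rational polyhedra, and
  Fourier-Motzkin elimination applies.
\<close>

section \<open>Optimal discrimination\<close>

lemma affine_fun_on_sum:
  assumes "\<And>x. x \<in> X \<Longrightarrow> affine_fun_on K (f x)"
  shows "affine_fun_on K (\<lambda>s. \<Sum>x\<in>X. f x s)"
  unfolding affine_fun_on_def
proof (intro ballI)
  fix s s' t assume *: "s \<in> K" "s' \<in> K" "t \<in> {0..1::real}"
  have "(\<Sum>x\<in>X. f x (convex_comb t s s')) = (\<Sum>x\<in>X. (1 - t) * f x s + t * f x s')"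
    using assms * unfolding affine_fun_on_def by (intro sum.cong) blast+
  then show "(\<Sum>x\<in>X. f x (convex_comb t s s')) = (1 - t) * (\<Sum>x\<in>X. f x s) + t * (\<Sum>x\<in>X. f x s')"
    by (simp add: sum.distrib sum_distrib_left)
qed

lemma measurement_le_one:
  assumes "measurement K X e" "x \<in> X" "s \<in> K"
  shows "e x s \<le> 1"
proof -
  have "e x s \<le> (\<Sum>y\<in>X. e y s)"
    using assms unfolding measurement_def by (intro member_le_sum) auto
  with assms show ?thesis unfolding measurement_def by simp
qed

text \<open>Post-processing: \<open>g\<close> relabels the outcomes, and effects that receive the
  same label are added. This turns a decision rule on the outcomes in \<open>X\<close> into a
  measurement indexed by the states to be guessed.\<close>

lemma measurement_coarsen:
  assumes e: "measurement K X e" and g: "g ` X \<subseteq> Y" and Y: "finite Y"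
  shows "measurement K Y (\<lambda>y s. \<Sum>x | x \<in> X \<and> g x = y. e x s)"
proof -
  have X: "finite X" using e by (simp add: measurement_def)
  have "(\<Sum>y\<in>Y. \<Sum>x | x \<in> X \<and> g x = y. e x s) = 1" if "s \<in> K" for s
    using sum.group[OF X Y g, of "\<lambda>x. e x s"] e that by (simp add: measurement_def)
  moreover have "affine_fun_on K (\<lambda>s. \<Sum>x | x \<in> X \<and> g x = y. e x s)" for y
    using e by (intro affine_fun_on_sum) (simp add: measurement_def)
  ultimately show ?thesis
    using e Y unfolding measurement_def by (auto intro!: sum_nonneg)
qed

text \<open>The fibres of \<open>g\<close> partition \<open>X\<close>, and on the fibre over
  \<open>y\<close> the second argument of \<open>f\<close> is \<open>g x\<close>.\<close>

lemma sum_coarsen: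
  assumes "finite X" "finite Y" "g ` X \<subseteq> Y"
  shows "(\<Sum>y\<in>Y. \<Sum>x | x \<in> X \<and> g x = y. f x y) = (\<Sum>x\<in>X. f x (g x))"
proof -
  have "(\<Sum>y\<in>Y. \<Sum>x | x \<in> X \<and> g x = y. f x y) =
      (\<Sum>y\<in>Y. \<Sum>x | x \<in> X \<and> g x = y. f x (g x))"
    by (intro sum.cong refl) auto
  also have "\<dots> = (\<Sum>x\<in>X. f x (g x))" by (rule sum.group[OF assms])
  finally show ?thesis .
qed

section \<open>Compactness of the set of measurements and attainment of the maximum\<close>

lemma compact_PiE_UNIV:
  fixes S :: "'i \<Rightarrow> 'a :: topological_space set"
  assumes "\<And>i. compact (S i)"
  shows "compact (PiE UNIV S)"
  using assms compactin_PiE[of "\<lambda>_. euclidean" UNIV S] by (simp add: euclidean_product_topology)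

lemma continuous_on_eval: "continuous_on A (\<lambda>w :: 'a \<Rightarrow> real. w k)"
  by (rule continuous_on_subset[OF continuous_on_product_coordinates]) simp

lemma continuous_on_eval2: "continuous_on A (\<lambda>e :: 'a \<Rightarrow> 'b \<Rightarrow> real. e x s)"
  by (rule continuous_on_subset[OF continuous_on_product_then_coordinatewise
      [OF continuous_on_product_coordinates]]) simp

text \<open>With the values outside \<open>H\<close> and \<open>K\<close> fixed at 0, all
  measurements lie in a power of \<open>[0,1]\<close>, compact by Tychonoff. Each remaining
  condition relates finitely many values, hence is closed for pointwise convergence. A measurement
  has a finite index set, so the set is empty if \<open>H\<close> is infinite.\<close>

lemma compact_measurements:
  "compact {e. measurement K H e \<and> (\<forall>x s. x \<notin> H \<or> s \<notin> K \<longrightarrow> e x s = 0)}" (is "compact ?S")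
proof (cases "finite H")
  case True
  define C :: "('a \<Rightarrow> (nat \<Rightarrow> real) \<Rightarrow> real) set"
    where "C = (\<Pi>\<^sub>E x\<in>UNIV. \<Pi>\<^sub>E s\<in>UNIV. {0..1})"
  \<comment> \<open>Nonnegativity is left to the cube \<open>C\<close>. Bounded quantifiers are
    spelled out as implications with constant premises, the form that the closedness rules can take
    apart.\<close>
  define D :: "('a \<Rightarrow> (nat \<Rightarrow> real) \<Rightarrow> real) set"
    where "D = {e. (\<forall>x s. x \<notin> H \<or> s \<notin> K \<longrightarrow> e x s = 0) \<and>
      (\<forall>x. x \<in> H \<longrightarrow> (\<forall>s. s \<in> K \<longrightarrow> (\<forall>s'. s' \<in> K \<longrightarrow> (\<forall>t. t \<in> {0..1} \<longrightarrow>
          e x (convex_comb t s s') = (1 - t) * e x s + t * e x s')))) \<and>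
      (\<forall>s. s \<in> K \<longrightarrow> (\<Sum>x\<in>H. e x s) = 1)}"
  have "compact C"
    unfolding C_def by (intro compact_PiE_UNIV compact_Icc)
  moreover have "closed D"
    unfolding D_def
    by (intro closed_Collect_conj closed_Collect_all closed_Collect_imp closed_Collect_eq
        continuous_intros continuous_on_eval2 open_Collect_const)
  moreover have "?S = C \<inter> D"
  proof (intro equalityI subsetI)
    fix e assume e: "e \<in> ?S"
    have "e x s \<in> {0..1}" for x s
    proof (cases "x \<in> H \<and> s \<in> K")
      case True
      with e measurement_le_one[of K H e x s] show ?thesis by (simp add: measurement_def)
    next
      case False
      with e show ?thesis by auto
    qed
    then have "e \<in> C" by (simp add: C_def PiE_iff)
    moreover have "e \<in> D"
      using e unfolding D_def measurement_def affine_fun_on_def mem_Collect_eq Ball_def by blast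
    ultimately show "e \<in> C \<inter> D" by blast
  next
    fix e assume e: "e \<in> C \<inter> D"
    then have "0 \<le> e x s" for x s by (simp add: C_def PiE_iff)
    then show "e \<in> ?S"
      using e True unfolding D_def measurement_def affine_fun_on_def mem_Collect_eq Ball_def Int_iff
      by blast
  qed
  ultimately show ?thesis by (metis compact_Int_closed)
qed (simp add: measurement_def)

text \<open>As \<open>K\<close> is convex, affinity on \<open>K\<close> involves only values on
  \<open>K\<close>, so effects may be changed freely elsewhere.\<close>

lemma measurement_cong:
  assumes "state_space d K" "measurement K H e"
    and eq: "\<And>x s. x \<in> H \<Longrightarrow> s \<in> K \<Longrightarrow> e' x s = e x s"
  shows "measurement K H e'"
proof -
  have "convex_comb t s s' \<in> K" if "s \<in> K" "s' \<in> K" "t \<in> {0..1}" for s s' t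
    using assms(1) that unfolding state_space_def by blast
  then have "affine_fun_on K (e' x) \<longleftrightarrow> affine_fun_on K (e x)" if "x \<in> H" for x
    unfolding affine_fun_on_def by (intro ball_cong refl) (simp add: eq that)
  moreover have "(\<Sum>x\<in>H. e' x s) = (\<Sum>x\<in>H. e x s)" if "s \<in> K" for s
    by (intro sum.cong refl eq that)
  ultimately show ?thesis
    using assms(2) unfolding measurement_def by (simp add: eq)
qed

lemma measurement_trivial:
  assumes "finite H" "j \<in> H"
  shows "measurement K H (\<lambda>i s. if i = j then 1 else 0)"
  using assms unfolding measurement_def affine_fun_on_def by simp

text \<open>The \<open>GREATEST\<close> in \<open>discrimination\<close> is a genuine maximum: the
  value is continuous for pointwise convergence, and the truncated measurements form a compact
  set.\<close>

lemma optimal_measurement: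
  fixes s :: "nat \<Rightarrow> nat \<Rightarrow> real"
  assumes K: "state_space d K" and H: "finite H" "H \<noteq> {}" and s: "s ` H \<subseteq> K"
  shows "\<exists>e. measurement K H e \<and> discrimination K s H = (\<Sum>i\<in>H. e i (s i)) \<and>
    (\<forall>e'. measurement K H e' \<longrightarrow> (\<Sum>i\<in>H. e' i (s i)) \<le> discrimination K s H)"
proof -
  define S where "S = {e. measurement K H e \<and> (\<forall>x s. x \<notin> H \<or> s \<notin> K \<longrightarrow> e x s = 0)}"
  \<comment> \<open>Zeroing a measurement outside \<open>H\<close> and \<open>K\<close> moves it
    into \<open>S\<close> and keeps its value, since every \<open>s i\<close> with \<open>i\<close>
    in \<open>H\<close> lies in \<open>K\<close>.\<close>
  define trunc where
    "trunc = (\<lambda>(e :: nat \<Rightarrow> (nat \<Rightarrow> real) \<Rightarrow> real) x s. if x \<in> H \<and> s \<in> K then e x s else 0)"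
  define val where "val = (\<lambda>e :: nat \<Rightarrow> (nat \<Rightarrow> real) \<Rightarrow> real. \<Sum>i\<in>H. e i (s i))"
  have trunc: "trunc e \<in> S" "val (trunc e) = val e" if e: "measurement K H e" for e
  proof -
    have "measurement K H (trunc e)"
      by (rule measurement_cong[OF K e]) (simp add: trunc_def)
    then show "trunc e \<in> S" by (simp add: S_def trunc_def)
    show "val (trunc e) = val e"
      unfolding val_def trunc_def by (intro sum.cong refl) (use s in \<open>simp add: image_subset_iff\<close>)
  qed
  obtain j where "j \<in> H" using H(2) by blast
  \<comment> \<open>Always guessing \<open>j\<close> is a measurement.\<close>
  then have "S \<noteq> {}"
    using trunc(1)[OF measurement_trivial[OF H(1)]] by blast
  moreover have "compact S" unfolding S_def by (rule compact_measurements)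
  moreover have "continuous_on S val"
    unfolding val_def by (intro continuous_intros continuous_on_eval2)
  ultimately obtain e where e: "e \<in> S" and max: "\<And>e'. e' \<in> S \<Longrightarrow> val e' \<le> val e"
    using continuous_attains_sup[of S val] by blast
  have max': "val e' \<le> val e" if "measurement K H e'" for e'
    using max[OF trunc(1)[OF that]] trunc(2)[OF that] by simp
  have eK: "measurement K H e" using e by (simp add: S_def)
  have "discrimination K s H = val e"
    unfolding discrimination_def if_not_P[OF H(2)]
    by (rule Greatest_equality) (use eK max' in \<open>unfold val_def, blast+\<close>)
  then show ?thesis using eK max' unfolding val_def by metis
qed

text \<open>Maximum-likelihood decoding: after outcome \<open>x\<close>, guess an index
  \<open>g x\<close> in \<open>H\<close> at which \<open>e x\<close> is largest. Coarsening
  \<open>e\<close> along \<open>g\<close> gives a measurement indexed by \<open>H\<close> whose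
  value is the left-hand side.\<close>

lemma sum_Max_le_discrimination:
  fixes s :: "nat \<Rightarrow> nat \<Rightarrow> real"
  assumes K: "state_space d K" and H: "finite H" "H \<noteq> {}" and s: "s ` H \<subseteq> K"
    and e: "measurement K X e"
  shows "(\<Sum>x\<in>X. Max ((\<lambda>i. e x (s i)) ` H)) \<le> discrimination K s H"
proof -
  have X: "finite X" using e by (simp add: measurement_def)
  have "\<exists>i\<in>H. Max ((\<lambda>i. e x (s i)) ` H) = e x (s i)" for x
    using Max_in[of "(\<lambda>i. e x (s i)) ` H"] H by blast
  then obtain g where g: "\<And>x. g x \<in> H" "\<And>x. Max ((\<lambda>i. e x (s i)) ` H) = e x (s (g x))"
    by metis
  have gX: "g ` X \<subseteq> H" using g(1) by blast
  have max: "(\<Sum>i\<in>H. e' i (s i)) \<le> discrimination K s H" if "measurement K H e'" for e'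
    using optimal_measurement[OF K H s] that by blast
  from max[OF measurement_coarsen[OF e gX H(1)]]
  show ?thesis by (simp add: sum_coarsen[OF X H(1) gX, of "\<lambda>x y. e x (s y)"] g(2))
qed

section \<open>Horizontal layers of a nonnegative function\<close>

text \<open>The coefficient \<open>c B\<close> is the height of the layer with base
  \<open>B\<close>. The bases are nested superlevel sets, so the layers that meet \<open>K\<close>
  add up to the maximum over \<open>K\<close>. The induction peels off the lowest layer, whose base
  is the support of \<open>p\<close>.\<close>

lemma layer_decomposition:
  fixes p :: "'a \<Rightarrow> real"
  assumes V: "finite V" and p: "\<And>i. i \<in> V \<Longrightarrow> 0 \<le> p i"
  shows "\<exists>c. (\<forall>B. 0 \<le> c B) \<and>
    (\<forall>K. K \<subseteq> V \<and> K \<noteq> {} \<longrightarrow> (\<Sum>B | B \<subseteq> V \<and> B \<inter> K \<noteq> {}. c B) = Max (p ` K))"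
  using p
proof (induction "card {i \<in> V. 0 < p i}" arbitrary: p rule: less_induct)
  case less
  define A where "A = {i \<in> V. 0 < p i}"
  have finA: "finite A" using V by (simp add: A_def)
  show ?case
  proof (cases "A = {}")
    case True
    then have "p i = 0" if "i \<in> V" for i
      using less.prems[OF that] that by (force simp: A_def)
    then have "Max (p ` K) = 0" if "K \<subseteq> V" "K \<noteq> {}" for K
    proof -
      have "p ` K = {0}" using that \<open>\<And>i. i \<in> V \<Longrightarrow> p i = 0\<close> by force
      then show ?thesis by simp
    qed
    then show ?thesis by (intro exI[of _ "\<lambda>_. 0"]) auto
  next
    case False
    define m where "m = Min (p ` A)"
    have m_le: "m \<le> p i" if "i \<in> A" for i
      using that finA by (simp add: m_def)
    obtain a where a: "a \<in> A" "p a = m"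
      using Min_in[of "p ` A"] False finA unfolding m_def
      by (metis (no_types, lifting) finite_imageI image_iff image_is_empty)
    then have m: "0 < m" by (auto simp: A_def)
    \<comment> \<open>Subtracting the least positive value \<open>m\<close> on the support makes
      \<open>q\<close> vanish at \<open>a\<close>, so the support shrinks strictly.\<close>
    define q where "q = (\<lambda>i. if i \<in> A then p i - m else p i)"
    have "{i \<in> V. 0 < q i} \<subset> A"
      using a m by (auto simp: q_def A_def)
    then have "card {i \<in> V. 0 < q i} < card {i \<in> V. 0 < p i}"
      using finA by (metis A_def psubset_card_mono)
    moreover have "0 \<le> q i" if "i \<in> V" for i
      using less.prems[OF that] m_le by (simp add: q_def)
    ultimately obtain c where c: "\<And>B. 0 \<le> c B"
      and cK: "\<And>K. K \<subseteq> V \<Longrightarrow> K \<noteq> {} \<Longrightarrow> (\<Sum>B | B \<subseteq> V \<and> B \<inter> K \<noteq> {}. c B) = Max (q ` K)"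
      using less.hyps[of q] by blast
    define c' where "c' = (\<lambda>B. c B + (if B = A then m else 0))"
    have "(\<Sum>B | B \<subseteq> V \<and> B \<inter> K \<noteq> {}. c' B) = Max (p ` K)" if K: "K \<subseteq> V" "K \<noteq> {}" for K
    proof -
      have finK: "finite K" using K V finite_subset by blast
      have "A \<subseteq> V" by (auto simp: A_def)
      then have *: "(\<Sum>B | B \<subseteq> V \<and> B \<inter> K \<noteq> {}. c' B) = Max (q ` K) + (if A \<inter> K \<noteq> {} then m else 0)"
        using V cK[OF K] by (simp add: c'_def sum.distrib)
      show ?thesis
      proof (cases "A \<inter> K = {}")
        case True
        then have "q ` K = p ` K" by (intro image_cong) (auto simp: q_def)
        with * True show ?thesis by simp
      next
        case False
        obtain j where j: "j \<in> K" "p j = Max (p ` K)"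
          using Max_in[of "p ` K"] finK K(2)
          by (metis (no_types, lifting) finite_imageI image_iff image_is_empty)
        have j_max: "p i \<le> p j" if "i \<in> K" for i
          using j that finK by simp
        obtain b where b: "b \<in> A" "b \<in> K" using False by auto
        then have pj: "m \<le> p j" using m_le[of b] j_max[of b] by linarith
        then have jA: "j \<in> A" using m j K by (auto simp: A_def)
        \<comment> \<open>On \<open>A\<close> both sides drop by \<open>m\<close>. Off
          \<open>A\<close> the value of \<open>q\<close> is at most 0, and \<open>p j - m\<close> is
          nonnegative by \<open>pj\<close>. Hence the maximum over \<open>K\<close> drops by exactly
          \<open>m\<close>.\<close>
        have "q i \<le> p j - m" if "i \<in> K" for i
          using j_max[OF that] that K pj by (auto simp: q_def A_def)
        moreover have "q j = p j - m" using jA by (simp add: q_def)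
        ultimately have "Max (q ` K) = p j - m"
          using finK j(1) by (intro Max_eqI) (auto simp: image_iff intro!: bexI[of _ j])
        with * False j show ?thesis by simp
      qed
    qed
    moreover have "0 \<le> c' B" for B using c m by (simp add: c'_def add_nonneg_nonneg)
    ultimately show ?thesis by blast
  qed
qed

section \<open>Fourier-Motzkin elimination\<close>

text \<open>Of the two groups of variables, the second is the one to be eliminated.\<close>

definition rational_system ::
    "'i set \<Rightarrow> 'k set \<Rightarrow> (('i \<Rightarrow> real) \<Rightarrow> ('k \<Rightarrow> real) \<Rightarrow> bool) \<Rightarrow> bool" where
  "rational_system I C R \<longleftrightarrow>
     (\<exists>L :: (('i \<Rightarrow> rat) \<times> ('k \<Rightarrow> rat) \<times> rat) set. finite L \<and>
        (\<forall>x c. R x c \<longleftrightarrow> (\<forall>(a, w, b)\<in>L.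
           (\<Sum>i\<in>I. of_rat (a i) * x i) + (\<Sum>k\<in>C. of_rat (w k) * c k) \<le> of_rat b)))"

lemma rational_system_le:
  "rational_system I C (\<lambda>x c.
     (\<Sum>i\<in>I. of_rat (a i) * x i) + (\<Sum>k\<in>C. of_rat (w k) * c k) \<le> of_rat b)"
  unfolding rational_system_def by (intro exI[of _ "{(a, w, b)}"]) simp

lemma rational_system_True: "rational_system I C (\<lambda>x c. True)"
  unfolding rational_system_def by (intro exI[of _ "{}"]) simp

lemma rational_system_conj:
  assumes "rational_system I C R" "rational_system I C S"
  shows "rational_system I C (\<lambda>x c. R x c \<and> S x c)"
proof -
  from assms obtain L M where "finite L" "finite M"
    and "\<And>x c. R x c \<longleftrightarrow> (\<forall>(a, w, b)\<in>L.
      (\<Sum>i\<in>I. of_rat (a i) * x i) + (\<Sum>k\<in>C. of_rat (w k) * c k) \<le> of_rat b)"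
    and "\<And>x c. S x c \<longleftrightarrow> (\<forall>(a, w, b)\<in>M.
      (\<Sum>i\<in>I. of_rat (a i) * x i) + (\<Sum>k\<in>C. of_rat (w k) * c k) \<le> of_rat b)"
    unfolding rational_system_def by blast
  then show ?thesis
    unfolding rational_system_def by (intro exI[of _ "L \<union> M"]) (auto simp: ball_Un)
qed

lemma rational_system_ball:
  assumes "finite A" "\<And>a. a \<in> A \<Longrightarrow> rational_system I C (R a)"
  shows "rational_system I C (\<lambda>x c. \<forall>a\<in>A. R a x c)"
  using assms by (induction A) (auto intro: rational_system_conj rational_system_True)

text \<open>The largest lower bound serves as \<open>t\<close>, or the smallest upper bound if there
  are no lower bounds.\<close>

lemma ex_between_finite:
  fixes lo :: "'a \<Rightarrow> real" and up :: "'b \<Rightarrow> real"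
  assumes "finite A" "finite B" "\<And>a b. a \<in> A \<Longrightarrow> b \<in> B \<Longrightarrow> lo a \<le> up b"
  shows "\<exists>t. (\<forall>a\<in>A. lo a \<le> t) \<and> (\<forall>b\<in>B. t \<le> up b)"
proof (cases "A = {}")
  case True
  show ?thesis
  proof (cases "B = {}")
    case False
    with True assms show ?thesis by (intro exI[of _ "Min (up ` B)"]) auto
  qed (use True in auto)
next
  case False
  with assms show ?thesis by (intro exI[of _ "Max (lo ` A)"]) auto
qed

text \<open>For fixed \<open>x\<close> and \<open>c\<close>, each inequality bounds \<open>t\<close>
  from above, bounds it from below, or does not involve it, according to the sign of its coefficient
  at \<open>k\<close>. A suitable \<open>t\<close> exists iff the inequalities free of
  \<open>t\<close> hold and each lower bound is at most each upper bound.\<close>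

lemma rational_system_eliminate_one:
  fixes R :: "('a \<Rightarrow> real) \<Rightarrow> ('b \<Rightarrow> real) \<Rightarrow> bool"
  assumes C: "finite C" "k \<notin> C" and R: "rational_system I (insert k C) R"
  shows "rational_system I C (\<lambda>x c. \<exists>t. R x (c(k := t)))"
proof -
  from R obtain L :: "(('a \<Rightarrow> rat) \<times> ('b \<Rightarrow> rat) \<times> rat) set" where L: "finite L"
    and LR: "\<And>x c. R x c \<longleftrightarrow> (\<forall>(a, w, b)\<in>L. (\<Sum>i\<in>I. of_rat (a i) * x i) +
      (\<Sum>j\<in>insert k C. of_rat (w j) * c j) \<le> of_rat b)"
    unfolding rational_system_def by auto
  \<comment> \<open>An inequality \<open>l\<close> at \<open>c(k := t)\<close> reads
    \<open>h l * t <= f x c l\<close>: \<open>f\<close> is the right-hand side left after moving all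
    other terms, \<open>h\<close> the coefficient at \<open>k\<close>.\<close>
  define f :: "('a \<Rightarrow> real) \<Rightarrow> ('b \<Rightarrow> real) \<Rightarrow> (('a \<Rightarrow> rat) \<times> ('b \<Rightarrow> rat) \<times> rat) \<Rightarrow> real"
    where "f = (\<lambda>x c (a, w, b). of_rat b - (\<Sum>i\<in>I. of_rat (a i) * x i) - (\<Sum>k\<in>C. of_rat (w k) * c k))"
  define h :: "(('a \<Rightarrow> rat) \<times> ('b \<Rightarrow> rat) \<times> rat) \<Rightarrow> rat" where "h = (\<lambda>(a, w, b). w k)"
  \<comment> \<open>For \<open>l\<close> in \<open>P\<close> and \<open>l'\<close> in
    \<open>N\<close> the multipliers \<open>w k\<close> and \<open>- w' k\<close> are positive. They
    cancel the coefficient at \<open>k\<close> and keep the others rational.\<close>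
  define comb :: "(('a \<Rightarrow> rat) \<times> ('b \<Rightarrow> rat) \<times> rat) \<Rightarrow> (('a \<Rightarrow> rat) \<times> ('b \<Rightarrow> rat) \<times> rat) \<Rightarrow>
      (('a \<Rightarrow> rat) \<times> ('b \<Rightarrow> rat) \<times> rat)"
    where "comb = (\<lambda>(a, w, b) (a', w', b').
      (\<lambda>i. w k * a' i - w' k * a i, \<lambda>i. w k * w' i - w' k * w i, w k * b' - w' k * b))"
  define P N Z where "P = {l \<in> L. 0 < h l}" and "N = {l \<in> L. h l < 0}" and "Z = {l \<in> L. h l = 0}"
  define L' where "L' = Z \<union> (\<lambda>(l, l'). comb l l') ` (P \<times> N)"
  have fin: "finite P" "finite N" "finite Z" using L by (simp_all add: P_def N_def Z_def)
  have f_comb: "f x c (comb l l') = of_rat (h l) * f x c l' - of_rat (h l') * f x c l" for x c l l'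
    by (cases l; cases l')
      (simp add: f_def comb_def h_def of_rat_diff of_rat_mult algebra_simps sum_subtractf
        sum_distrib_left)
  have R_iff: "R x (c(k := t)) \<longleftrightarrow> (\<forall>l\<in>L. of_rat (h l) * t \<le> f x c l)" for x c t
  proof -
    have "(\<Sum>j\<in>insert k C. of_rat (w j) * (c(k := t)) j) =
        of_rat (w k) * t + (\<Sum>j\<in>C. of_rat (w j) * c j)" for w :: "'b \<Rightarrow> rat"
      using C by (auto intro!: sum.cong)
    then show ?thesis
      unfolding LR by (intro ball_cong refl) (auto simp: f_def h_def algebra_simps)
  qed
  have "(\<exists>t. R x (c(k := t))) \<longleftrightarrow> (\<forall>l\<in>L'. 0 \<le> f x c l)" for x c
  proof
    assume "\<exists>t. R x (c(k := t))"
    then obtain t where t: "\<And>l. l \<in> L \<Longrightarrow> of_rat (h l) * t \<le> f x c l" using R_iff by blast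
    have "0 \<le> f x c (comb l l')" if "l \<in> P" "l' \<in> N" for l l'
    proof -
      have "of_rat (h l) * (of_rat (h l') * t) \<le> of_rat (h l) * f x c l'"
        using t[of l'] that by (intro mult_left_mono) (auto simp: P_def N_def)
      moreover have "of_rat (h l') * f x c l \<le> of_rat (h l') * (of_rat (h l) * t)"
        using t[of l] that by (intro mult_left_mono_neg) (auto simp: P_def N_def)
      ultimately show ?thesis by (simp add: f_comb algebra_simps)
    qed
    moreover have "0 \<le> f x c l" if "l \<in> Z" for l
      using t[of l] that by (simp add: Z_def)
    ultimately show "\<forall>l\<in>L'. 0 \<le> f x c l" by (auto simp: L'_def)
  next
    assume *: "\<forall>l\<in>L'. 0 \<le> f x c l"
    \<comment> \<open>Dividing the combined inequality by the negative number
      \<open>h l * h l'\<close> compares the two bounds on \<open>t\<close>.\<close>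
    have "f x c l' / of_rat (h l') \<le> f x c l / of_rat (h l)" if l: "l \<in> P" "l' \<in> N" for l l'
    proof -
      have "0 \<le> f x c (comb l l')" using * l by (auto simp: L'_def)
      moreover have "0 < (of_rat (h l) :: real)" "(of_rat (h l') :: real) < 0"
        using l by (auto simp: P_def N_def)
      ultimately show ?thesis by (simp add: f_comb field_simps)
    qed
    then obtain t where t: "\<And>l. l \<in> N \<Longrightarrow> f x c l / of_rat (h l) \<le> t"
      "\<And>l. l \<in> P \<Longrightarrow> t \<le> f x c l / of_rat (h l)"
      using ex_between_finite[OF fin(2,1), of "\<lambda>l. f x c l / of_rat (h l)"
          "\<lambda>l. f x c l / of_rat (h l)"] by blast
    have "of_rat (h l) * t \<le> f x c l" if l: "l \<in> L" for l
    proof -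
      consider "l \<in> P" | "l \<in> N" | "l \<in> Z"
        using l linorder_less_linear[of "h l" 0] unfolding P_def N_def Z_def by blast
      then show ?thesis
      proof cases
        case 1
        then show ?thesis using t(2)[OF 1] by (simp add: P_def field_simps)
      next
        case 2
        then show ?thesis using t(1)[OF 2] by (simp add: N_def field_simps)
      next
        case 3
        then show ?thesis using * by (simp add: L'_def Z_def)
      qed
    qed
    then have "R x (c(k := t))" unfolding R_iff by blast
    then show "\<exists>t. R x (c(k := t))" by blast
  qed
  moreover have "(\<forall>l\<in>L'. 0 \<le> f x c l) \<longleftrightarrow> (\<forall>(a, w, b)\<in>L'.
      (\<Sum>i\<in>I. of_rat (a i) * x i) + (\<Sum>k\<in>C. of_rat (w k) * c k) \<le> of_rat b)" for x c
    by (intro ball_cong refl) (auto simp: f_def)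
  moreover have "finite L'" using fin by (simp add: L'_def)
  ultimately show ?thesis
    unfolding rational_system_def by (intro exI[of _ L']) simp
qed

text \<open>One variable at a time: the inner quantifier over the value at \<open>k\<close> is
  absorbed by the quantifier over all of \<open>c\<close>.\<close>

lemma rational_system_eliminate:
  fixes R :: "('i \<Rightarrow> real) \<Rightarrow> ('k \<Rightarrow> real) \<Rightarrow> bool"
  assumes "finite C" "rational_system I C R"
  shows "rational_system I {} (\<lambda>x (_ :: 'k \<Rightarrow> real). \<exists>c. R x c)"
  using assms
proof (induction C arbitrary: R)
  case empty
  then have "R x c \<longleftrightarrow> R x c'" for x c c'
    by (auto simp: rational_system_def)
  \<comment> \<open>With no variable left to eliminate, \<open>R\<close> does not depend on its
    second argument.\<close>
  then have eq: "(\<lambda>x _. \<exists>c. R x c) = R" by (intro ext) blast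
  show ?case unfolding eq by (rule empty.prems)
next
  case (insert k C)
  have eq: "(\<exists>c t. R x (c(k := t))) \<longleftrightarrow> (\<exists>c. R x c)" for x
  proof
    assume "\<exists>c. R x c"
    then obtain c where "R x (c(k := c k))" by auto
    then show "\<exists>c t. R x (c(k := t))" by blast
  qed blast
  with insert.IH[OF rational_system_eliminate_one[OF insert.hyps insert.prems]]
  show ?case by (simp only: eq)
qed

lemma rational_system_polyhedron:
  assumes "rational_system I {} R"
  shows "\<exists>L :: (('i \<Rightarrow> rat) \<times> rat) set. finite L \<and>
    {x \<in> I \<rightarrow>\<^sub>E UNIV. R x c} = {x \<in> I \<rightarrow>\<^sub>E UNIV. \<forall>(a, b)\<in>L. (\<Sum>i\<in>I. of_rat (a i) * x i) \<le> of_rat b}"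
proof -
  from assms obtain L where "finite L" "\<And>x c. R x c \<longleftrightarrow> (\<forall>(a, w, b)\<in>L.
      (\<Sum>i\<in>I. of_rat (a i) * x i) + (\<Sum>k\<in>{}. of_rat (w k) * c k) \<le> of_rat b)"
    unfolding rational_system_def by blast
  then show ?thesis
    by (intro exI[of _ "(\<lambda>(a, w, b). (a, b)) ` L"]) (auto simp: split_beta)
qed

section \<open>Products of simplices\<close>

text \<open>The \<open>d\<close> coordinates are distributed over the factors by \<open>g\<close>:
  the fibre of \<open>g\<close> over \<open>j\<close> holds the barycentric coordinates of factor
  \<open>j\<close>. Flattening the product in this way places it in
  \<open>Euclidean_space d\<close>.\<close>

definition simplex_product :: "nat \<Rightarrow> (nat \<Rightarrow> 'j) \<Rightarrow> (nat \<Rightarrow> real) set" where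
  "simplex_product d g = {w. (\<forall>k. 0 \<le> w k) \<and> (\<forall>k\<ge>d. w k = 0) \<and>
     (\<forall>j\<in>g ` {..<d}. (\<Sum>k | k < d \<and> g k = j. w k) = 1)}"

lemma convex_comb_simplex_product:
  assumes "x \<in> simplex_product d g" "y \<in> simplex_product d g" "t \<in> {0..1}"
  shows "convex_comb t x y \<in> simplex_product d g"
  using assms
  by (auto simp: simplex_product_def convex_comb_def sum.distrib simp flip: sum_distrib_left)

lemma simplex_product_coord_le_one:
  assumes "w \<in> simplex_product d g"
  shows "w k \<le> 1"
proof (cases "k < d")
  case True
  have "w k \<le> (\<Sum>l | l < d \<and> g l = g k. w l)"
    using assms True by (intro member_le_sum) (auto simp: simplex_product_def)
  also have "\<dots> = 1" using assms True by (auto simp: simplex_product_def)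
  finally show ?thesis .
qed (use assms in \<open>simp add: simplex_product_def\<close>)

text \<open>The set is cut out of a compact cube by closed linear conditions. Its points vanish from
  index \<open>d\<close> on, so compactness passes to the subspace
  \<open>Euclidean_space d\<close>.\<close>

lemma state_space_simplex_product:
  assumes "simplex_product d g \<noteq> {}"
  shows "state_space d (simplex_product d g)"
proof -
  define D where "D = {w :: nat \<Rightarrow> real. \<forall>j. j \<in> g ` {..<d} \<longrightarrow> (\<Sum>k | k < d \<and> g k = j. w k) = 1}"
  define Z where "Z = {w :: nat \<Rightarrow> real. \<forall>k. k \<ge> d \<longrightarrow> w k = 0}"
  have "compact (PiE UNIV (\<lambda>k. {0..1}) :: (nat \<Rightarrow> real) set)"
    by (intro compact_PiE_UNIV compact_Icc)
  moreover have "closed D" unfolding D_def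
    by (intro closed_Collect_all closed_Collect_imp closed_Collect_eq continuous_intros
        continuous_on_eval open_Collect_const)
  moreover have "closed Z" unfolding Z_def
    by (intro closed_Collect_all closed_Collect_imp closed_Collect_eq continuous_intros
        continuous_on_eval open_Collect_const)
  moreover have "simplex_product d g = (PiE UNIV (\<lambda>k. {0..1}) \<inter> D) \<inter> Z"
    using simplex_product_coord_le_one[of _ d g]
    by (auto simp: simplex_product_def D_def Z_def PiE_iff)
  ultimately have "compact (simplex_product d g)"
    by (simp add: compact_Int_closed)
  then have "compactin (Euclidean_space d) (simplex_product d g)"
    by (auto simp: Euclidean_space_def compactin_subtopology euclidean_product_topology
        simplex_product_def)
  with assms show ?thesis
    unfolding state_space_def by (blast intro: convex_comb_simplex_product)
qed

text \<open>Reading off factor \<open>j\<close>: its barycentric coordinates are the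
  effects.\<close>

lemma measurement_simplex_product_block:
  assumes "j \<in> g ` {..<d}"
  shows "measurement (simplex_product d g) {k. k < d \<and> g k = j} (\<lambda>k w. w k)"
  using assms by (auto simp: measurement_def affine_fun_on_def convex_comb_def simplex_product_def)

text \<open>The remainder \<open>l * w - u\<close> is nonnegative and has mass \<open>l - 1\<close>
  on every factor, so normalizing it gives \<open>v\<close>. In the combination \<open>u\<close> has
  weight \<open>1 / l\<close>.\<close>

lemma simplex_product_dominated:
  assumes w: "w \<in> simplex_product d g" and u: "u \<in> simplex_product d g"
    and l: "1 < l" and le: "\<And>k. u k \<le> l * w k"
  shows "\<exists>v\<in>simplex_product d g. w = convex_comb (1 - 1 / l) u v"
proof
  define v where "v = (\<lambda>k. (l * w k - u k) / (l - 1))"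
  show "w = convex_comb (1 - 1 / l) u v"
    using l by (auto simp: convex_comb_def v_def field_simps)
  have "(\<Sum>k | k < d \<and> g k = j. v k) = 1" if "j \<in> g ` {..<d}" for j
  proof -
    have "(\<Sum>k | k < d \<and> g k = j. v k) =
        (l * (\<Sum>k | k < d \<and> g k = j. w k) - (\<Sum>k | k < d \<and> g k = j. u k)) / (l - 1)"
      by (simp add: v_def sum_subtractf sum_distrib_left flip: sum_divide_distrib)
    also have "(\<Sum>k | k < d \<and> g k = j. w k) = 1"
      using w that unfolding simplex_product_def by blast
    also have "(\<Sum>k | k < d \<and> g k = j. u k) = 1"
      using u that unfolding simplex_product_def by blast
    finally have "(\<Sum>k | k < d \<and> g k = j. v k) = (l * 1 - 1) / (l - 1)" .
    then show ?thesis using l by simp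
  qed
  then show "v \<in> simplex_product d g"
    using w u l le by (auto simp: simplex_product_def v_def)
qed

text \<open>Weak duality: \<open>l\<close> bounds the discrimination value as soon as \<open>l w\<close> dominates every
  state of the list in the cone order.\<close>

lemma measurement_sum_le:
  assumes e: "measurement K H e" and w: "w \<in> K" and l: "1 < l"
    and s: "\<And>i. i \<in> H \<Longrightarrow> s i \<in> K"
    and dom: "\<And>i. i \<in> H \<Longrightarrow> \<exists>v\<in>K. w = convex_comb (1 - 1 / l) (s i) v"
  shows "(\<Sum>i\<in>H. e i (s i)) \<le> l"
proof -
  have "e i (s i) \<le> l * e i w" if i: "i \<in> H" for i
  proof -
    obtain v where v: "v \<in> K" "w = convex_comb (1 - 1 / l) (s i) v"
      using dom[OF i] by blast
    have "affine_fun_on K (e i)" "0 \<le> e i v"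
      using e i v(1) by (auto simp: measurement_def)
    moreover have "1 - 1 / l \<in> {0..1}" using l by simp
    ultimately have "e i w = (1 - (1 - 1 / l)) * e i (s i) + (1 - 1 / l) * e i v"
      using s[OF i] v unfolding affine_fun_on_def by blast
    \<comment> \<open>The last term is nonnegative and may be dropped. Summed over \<open>i\<close>,
      the effects at \<open>w\<close> give 1, which leaves the bound \<open>l\<close>.\<close>
    then have "l * e i w = e i (s i) + (l - 1) * e i v"
      using l by (simp add: field_simps)
    then show ?thesis using l \<open>0 \<le> e i v\<close> by simp
  qed
  then have "(\<Sum>i\<in>H. e i (s i)) \<le> l * (\<Sum>i\<in>H. e i w)"
    by (simp add: sum_mono sum_distrib_left)
  then show ?thesis using e w by (simp add: measurement_def)
qed

text \<open>Each \<open>j\<close> is a classical experiment with outcome distributions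
  \<open>p j _ i\<close>, and the inner sum of maxima is its maximum-likelihood value. In the
  product of simplices one factor can be read off, so the best experiment is a lower bound; weak
  duality with a common dominating state gives the upper bound.\<close>

lemma product_realization:
  fixes p :: "'j \<Rightarrow> 'b \<Rightarrow> nat \<Rightarrow> real"
  assumes J: "finite J" "J \<noteq> {}" and X: "finite X" "X \<noteq> {}" and V: "V \<noteq> {}"
    and p_nonneg: "\<And>j b i. j \<in> J \<Longrightarrow> b \<in> X \<Longrightarrow> i \<in> V \<Longrightarrow> 0 \<le> p j b i"
    and p_sum: "\<And>j i. j \<in> J \<Longrightarrow> i \<in> V \<Longrightarrow> (\<Sum>b\<in>X. p j b i) = 1"
  shows "\<exists>d K s. 1 \<le> d \<and> state_space d K \<and> (\<forall>i\<in>V. s i \<in> K) \<and>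
    (\<forall>H. finite H \<and> H \<noteq> {} \<and> H \<subseteq> V \<longrightarrow>
      discrimination K s H = Max ((\<lambda>j. \<Sum>b\<in>X. Max (p j b ` H)) ` J))"
proof -
  define d where "d = card (J \<times> X)"
  have d: "1 \<le> d" using J X by (simp add: d_def card_gt_0_iff Suc_le_eq)
  \<comment> \<open>Coordinate \<open>k\<close> stands for the pair \<open>h k\<close> of a factor
    and an outcome.\<close>
  obtain h where h: "bij_betw h {..<d} (J \<times> X)"
    using ex_bij_betw_nat_finite[of "J \<times> X"] J X unfolding d_def atLeast0LessThan by auto
  define g where "g = (\<lambda>k. fst (h k))"
  define S where "S = simplex_product d g"
  have hJX: "g k \<in> J" "snd (h k) \<in> X" if "k < d" for k
    using bij_betw_apply[OF h, of k] that by (auto simp: g_def mem_Times_iff)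
  have gJ: "g ` {..<d} = J"
    using bij_betw_imp_surj_on[OF h] X(2) unfolding g_def by (metis fst_image_times image_image)
  have block: "bij_betw (\<lambda>k. snd (h k)) {k. k < d \<and> g k = j} X" if j: "j \<in> J" for j
  proof (rule bij_betw_imageI)
    show "inj_on (\<lambda>k. snd (h k)) {k. k < d \<and> g k = j}"
      using bij_betw_imp_inj_on[OF h] by (auto simp: inj_on_def g_def prod_eq_iff)
    show "(\<lambda>k. snd (h k)) ` {k. k < d \<and> g k = j} = X"
    proof (intro equalityI subsetI)
      fix b assume "b \<in> X"
      then have "(j, b) \<in> h ` {..<d}" using j bij_betw_imp_surj_on[OF h] by simp
      then obtain k where "k < d" "h k = (j, b)" by (metis imageE lessThan_iff)
      then show "b \<in> (\<lambda>k. snd (h k)) ` {k. k < d \<and> g k = j}"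
        by (intro image_eqI[of _ _ k]) (simp_all add: g_def)
    qed (use hJX in auto)
  qed
  define emb where "emb = (\<lambda>W k. if k < d then W (g k) (snd (h k)) else (0 :: real))"
  have emb_block: "(\<Sum>k | k < d \<and> g k = j. W (g k) (snd (h k))) = (\<Sum>b\<in>X. W j b)"
    if "j \<in> J" for W :: "'j \<Rightarrow> 'b \<Rightarrow> real" and j
  proof -
    have "(\<Sum>k | k < d \<and> g k = j. W (g k) (snd (h k))) = (\<Sum>k | k < d \<and> g k = j. W j (snd (h k)))"
      by (intro sum.cong refl) auto
    then show ?thesis using sum.reindex_bij_betw[OF block[OF that], of "W j"] by simp
  qed
  have emb_S: "emb W \<in> S"
    if "\<And>j b. j \<in> J \<Longrightarrow> b \<in> X \<Longrightarrow> 0 \<le> W j b" "\<And>j. j \<in> J \<Longrightarrow> (\<Sum>b\<in>X. W j b) = 1" for W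
  proof -
    have "(\<Sum>k | k < d \<and> g k = j. emb W k) = (\<Sum>b\<in>X. W j b)" if "j \<in> J" for j
      unfolding emb_block[OF that, of W, symmetric] by (intro sum.cong refl) (auto simp: emb_def)
    then show ?thesis
      using that hJX unfolding S_def simplex_product_def gJ by (simp add: emb_def)
  qed
  define s where "s = (\<lambda>i. emb (\<lambda>j b. p j b i))"
  have s: "s i \<in> S" if "i \<in> V" for i
    unfolding s_def using p_nonneg p_sum that by (intro emb_S) auto
  have state: "state_space d S"
    using s V unfolding S_def by (intro state_space_simplex_product) blast
  have "discrimination S s H = Max ((\<lambda>j. \<Sum>b\<in>X. Max (p j b ` H)) ` J)" (is "_ = Max (?T ` J)")
    if H: "finite H" "H \<noteq> {}" "H \<subseteq> V" for H
  proof (rule antisym)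
    have sH: "s ` H \<subseteq> S" using s H(3) by blast
    have M: "p j b i \<le> Max (p j b ` H)" if "i \<in> H" for j b i
      using that H(1) by simp
    have T_le: "?T j \<le> Max (?T ` J)" if "j \<in> J" for j
      using that J(1) by simp
    obtain i where i: "i \<in> H" using H(2) by blast
    obtain j0 where j0: "j0 \<in> J" using J(2) by blast
    \<comment> \<open>Comparison with the single state \<open>i\<close> shows that the claimed value
      is at least 1, so any larger \<open>l\<close> satisfies \<open>1 < l\<close> as weak duality
      demands.\<close>
    have "1 = (\<Sum>b\<in>X. p j0 b i)" using p_sum j0 i H(3) by auto
    also have "\<dots> \<le> ?T j0" using M[OF i] by (intro sum_mono)
    finally have T_ge: "1 \<le> Max (?T ` J)" using T_le[OF j0] by linarith
    obtain e where e: "measurement S H e" "discrimination S s H = (\<Sum>i\<in>H. e i (s i))"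
      using optimal_measurement[OF state H(1,2), of s] sH by blast
    \<comment> \<open>Weak duality is applied to every \<open>l\<close> strictly above the claimed
      value; density of the reals then gives the bound itself.\<close>
    have "(\<Sum>i\<in>H. e i (s i)) \<le> l" if l: "Max (?T ` J) < l" for l
    proof -
      \<comment> \<open>On factor \<open>j\<close> the pointwise maximum over \<open>H\<close> has
        mass \<open>?T j\<close>, which may differ between factors. A multiple of the state
        \<open>i\<close> fills the missing mass \<open>l - ?T j\<close>, so every factor has total
        \<open>l\<close> before division by \<open>l\<close>, and \<open>l * w\<close> still
        dominates every state.\<close>
      define w where "w = emb (\<lambda>j b. (Max (p j b ` H) + (l - ?T j) * p j b i) / l)"
      have l1: "1 < l" using l T_ge by linarith
      have p0: "0 \<le> p j b i" if "j \<in> J" "b \<in> X" for j b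
        using p_nonneg that i H(3) by blast
      have M0: "0 \<le> Max (p j b ` H)" if "j \<in> J" "b \<in> X" for j b
        using p0[OF that] M[OF i, of j b] by linarith
      have Tl: "0 \<le> l - ?T j" if "j \<in> J" for j using T_le[OF that] l by linarith
      have w: "w \<in> S" unfolding w_def
      proof (rule emb_S)
        fix j b assume "j \<in> J" "b \<in> X"
        then show "0 \<le> (Max (p j b ` H) + (l - ?T j) * p j b i) / l"
          using p0 M0 Tl l1 by simp
      next
        fix j assume j: "j \<in> J"
        have "(\<Sum>b\<in>X. (Max (p j b ` H) + (l - ?T j) * p j b i) / l) =
            (?T j + (l - ?T j) * (\<Sum>b\<in>X. p j b i)) / l"
          by (simp add: sum.distrib sum_distrib_left flip: sum_divide_distrib)
        also have "\<dots> = 1" using p_sum j i H(3) l1 by (simp add: subset_iff)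
        finally show "(\<Sum>b\<in>X. (Max (p j b ` H) + (l - ?T j) * p j b i) / l) = 1" .
      qed
      have "s i' k \<le> l * w k" if i': "i' \<in> H" for i' k
      proof (cases "k < d")
        case True
        have "0 \<le> (l - ?T (g k)) * p (g k) (snd (h k)) i"
          using hJX[OF True] p0 Tl by (intro mult_nonneg_nonneg) auto
        then show ?thesis using True M[OF i', of "g k" "snd (h k)"] l1
          by (simp add: s_def w_def emb_def)
      qed (simp add: s_def w_def emb_def)
      then show ?thesis
        using w sH l1 unfolding S_def image_subset_iff
        by (intro measurement_sum_le[OF e(1)[unfolded S_def]] simplex_product_dominated) auto
    qed
    then show "discrimination S s H \<le> Max (?T ` J)"
      unfolding e(2) by (rule dense_ge)
  next
    \<comment> \<open>The lower bound comes from reading off a best factor.\<close>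
    obtain j where j: "j \<in> J" "Max (?T ` J) = ?T j"
      using Max_in[of "?T ` J"] J by blast
    have "?T j = (\<Sum>k | k < d \<and> g k = j. Max (p (g k) (snd (h k)) ` H))"
      using emb_block[OF j(1), of "\<lambda>j b. Max (p j b ` H)"] by simp
    also have "\<dots> = (\<Sum>k | k < d \<and> g k = j. Max ((\<lambda>i. s i k) ` H))"
      by (intro sum.cong refl) (simp add: s_def emb_def)
    also have "\<dots> \<le> discrimination S s H"
      using s H(3) j(1) gJ unfolding S_def
      by (intro sum_Max_le_discrimination[OF state[unfolded S_def] H(1,2)]
          measurement_simplex_product_block image_subsetI) auto
    finally show "Max (?T ` J) \<le> discrimination S s H" using j(2) by simp
  qed
  then show ?thesis
    using d state s by (intro exI[of _ d] exI[of _ S] exI[of _ s]) simp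
qed

section \<open>The profile region\<close>

text \<open>The functions \<open>i \<mapsto> e x (s i)\<close> are decomposed into layers for each
  outcome \<open>x\<close>, and the layer heights are added over \<open>x\<close>.\<close>

lemma measurement_coefficients:
  fixes s :: "nat \<Rightarrow> nat \<Rightarrow> real"
  assumes e: "measurement S X e" and s: "s ` {1..n} \<subseteq> S"
  shows "\<exists>c\<in>coefficient_polytope n. \<forall>K. K \<subseteq> {1..n} \<and> K \<noteq> {} \<longrightarrow>
    theta n c K = (\<Sum>x\<in>X. Max ((\<lambda>i. e x (s i)) ` K))"
proof -
  define layers where "layers = (\<lambda>x c. (\<forall>B :: nat set. 0 \<le> c B) \<and>
    (\<forall>K. K \<subseteq> {1..n} \<and> K \<noteq> {} \<longrightarrow>
      (\<Sum>B | B \<subseteq> {1..n} \<and> B \<inter> K \<noteq> {}. c B) = Max ((\<lambda>i. e x (s i)) ` K)))"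
  have "\<exists>c. layers x c" if "x \<in> X" for x
    unfolding layers_def using e s that
    by (intro layer_decomposition) (auto simp: measurement_def image_subset_iff)
  then obtain c where layers: "\<And>x. x \<in> X \<Longrightarrow> layers x (c x)" by metis
  have c: "0 \<le> c x B" if "x \<in> X" for x B
    using layers[OF that] unfolding layers_def by blast
  have cK: "(\<Sum>B | B \<subseteq> {1..n} \<and> B \<inter> K \<noteq> {}. c x B) = Max ((\<lambda>i. e x (s i)) ` K)"
    if "x \<in> X" "K \<subseteq> {1..n}" "K \<noteq> {}" for x K
    using layers[OF that(1)] that(2,3) unfolding layers_def by blast
  define c' where "c' = restrict (\<lambda>B. \<Sum>x\<in>X. c x B) (Pow {1..n} - {{}})"
  have theta: "theta n c' K = (\<Sum>x\<in>X. Max ((\<lambda>i. e x (s i)) ` K))"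
    if K: "K \<subseteq> {1..n}" "K \<noteq> {}" for K
  proof -
    have "theta n c' K = (\<Sum>B | B \<subseteq> {1..n} \<and> B \<inter> K \<noteq> {}. \<Sum>x\<in>X. c x B)"
      unfolding theta_def c'_def by (intro sum.cong refl) auto
    also have "\<dots> = (\<Sum>x\<in>X. \<Sum>B | B \<subseteq> {1..n} \<and> B \<inter> K \<noteq> {}. c x B)" by (rule sum.swap)
    also have "\<dots> = (\<Sum>x\<in>X. Max ((\<lambda>i. e x (s i)) ` K))"
      by (intro sum.cong refl cK K)
    finally show ?thesis .
  qed
  have "(\<Sum>B | B \<subseteq> {1..n} \<and> i \<in> B. c' B) = 1" if i: "i \<in> {1..n}" for i
  proof -
    \<comment> \<open>The polytope constraint at \<open>i\<close> is the value of
      \<open>theta\<close> at a singleton, where it becomes normalization of the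
      measurement.\<close>
    have "(\<Sum>B | B \<subseteq> {1..n} \<and> i \<in> B. c' B) = theta n c' {i}"
      unfolding theta_def by (intro sum.cong) auto
    also have "\<dots> = (\<Sum>x\<in>X. e x (s i))" using theta[of "{i}"] i by simp
    also have "\<dots> = 1"
      using e s i unfolding measurement_def by (auto simp: image_subset_iff)
    finally show ?thesis .
  qed
  moreover have "c' \<in> (Pow {1..n} - {{}}) \<rightarrow>\<^sub>E {0..}"
    by (auto simp: c'_def intro!: sum_nonneg c)
  ultimately have "c' \<in> coefficient_polytope n" unfolding coefficient_polytope_def by blast
  then show ?thesis using theta by blast
qed

lemma profile_index_iff: "H \<in> profile_index n \<longleftrightarrow> H \<subseteq> {1..n} \<and> 2 \<le> card H"
  by (simp add: profile_index_def)

lemma profile_indexD: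
  assumes "H \<in> profile_index n"
  shows "H \<subseteq> {1..n}" "finite H" "H \<noteq> {}"
  using assms finite_subset[of H "{1..n}"] by (auto simp: profile_index_def)

lemma finite_profile_index: "finite (profile_index n)"
  by (rule finite_subset[of _ "Pow {1..n}"]) (auto simp: profile_index_def)

definition extremal_coefficients :: "nat \<Rightarrow> (nat set \<Rightarrow> real) \<Rightarrow> nat set \<Rightarrow> (nat set \<Rightarrow> real) \<Rightarrow> bool" where
  "extremal_coefficients n F H c \<longleftrightarrow>
     (\<forall>K\<in>profile_index n. F K \<le> coeff_error n c K) \<and> coeff_error n c H = F H"

lemma gpt_region_necessary:
  assumes F: "F \<in> gpt_region n" and H: "H \<in> profile_index n"
  shows "\<exists>c\<in>coefficient_polytope n. extremal_coefficients n F H c"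
proof -
  obtain d S s where S: "state_space d S" and s: "s ` {1..n} \<subseteq> S"
    and F_eq: "F = restrict (error_profile S s) (profile_index n)"
    using F unfolding gpt_region_def by blast
  have sK: "s ` K \<subseteq> S" if "K \<in> profile_index n" for K
    using s profile_indexD(1)[OF that] by blast
  note H' = profile_indexD[OF H]
  obtain e where e: "measurement S H e" "discrimination S s H = (\<Sum>i\<in>H. e i (s i))"
    using optimal_measurement[OF S H'(2,3) sK[OF H]] by blast
  obtain c where c: "c \<in> coefficient_polytope n"
    and theta: "\<And>K. K \<subseteq> {1..n} \<Longrightarrow> K \<noteq> {} \<Longrightarrow> theta n c K = (\<Sum>x\<in>H. Max ((\<lambda>i. e x (s i)) ` K))"
    using measurement_coefficients[OF e(1) s] by blast
  have le: "theta n c K \<le> discrimination S s K" if K: "K \<in> profile_index n" for K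
    using sum_Max_le_discrimination[OF S _ _ sK[OF K] e(1)] profile_indexD[OF K] theta by simp
  \<comment> \<open>The outcomes are the elements of \<open>H\<close> themselves, so
    \<open>e x (s x)\<close> is among the values maximized over \<open>H\<close>.\<close>
  have "discrimination S s H \<le> theta n c H"
    unfolding e(2) theta[OF H'(1,3)] using H'(2) by (intro sum_mono Max_ge) auto
  with le[OF H] have "theta n c H = discrimination S s H" by simp
  then have "extremal_coefficients n F H c"
    using le H unfolding extremal_coefficients_def
    by (simp add: F_eq coeff_error_def error_profile_def)
  with c show ?thesis by blast
qed

section \<open>Sufficiency of the coefficient condition\<close>

text \<open>The product realization has discrimination value at \<open>K\<close> equal to the
  maximum of \<open>theta n (c H) K\<close> over all \<open>H\<close>. Each of these is at most
  \<open>card K - F K\<close>, and \<open>H = K\<close> attains it.\<close>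

lemma gpt_region_sufficient:
  assumes n: "2 \<le> n" and F: "F \<in> profile_index n \<rightarrow>\<^sub>E UNIV"
    and ex: "\<And>H. H \<in> profile_index n \<Longrightarrow> \<exists>c\<in>coefficient_polytope n. extremal_coefficients n F H c"
  shows "F \<in> gpt_region n"
proof -
  define I where "I = profile_index n"
  have I: "finite I" "I \<noteq> {}"
    using n finite_profile_index by (auto simp: I_def profile_index_def intro!: exI[of _ "{1..n}"])
  obtain c where c: "\<And>H. H \<in> I \<Longrightarrow> c H \<in> coefficient_polytope n"
    and extremal: "\<And>H. H \<in> I \<Longrightarrow> extremal_coefficients n F H (c H)"
    using ex unfolding I_def by metis
  \<comment> \<open>The empty set is an allowed outcome here, but \<open>p\<close> vanishes there,
    so the undefined value of \<open>c H\<close> at it never enters.\<close>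
  define p where "p = (\<lambda>H B i. if i \<in> B then c H B else 0)"
  have c_nonneg: "0 \<le> c H B" if "H \<in> I" "B \<subseteq> {1..n}" "B \<noteq> {}" for H B
    using c[OF that(1)] that(2,3) unfolding coefficient_polytope_def
    by (force dest: PiE_mem[of _ _ _ B])
  have p_nonneg: "0 \<le> p H B i" if "H \<in> I" "B \<in> Pow {1..n}" for H B i
    using c_nonneg that by (auto simp: p_def)
  have p_sum: "(\<Sum>B\<in>Pow {1..n}. p H B i) = 1" if "H \<in> I" "i \<in> {1..n}" for H i
  proof -
    have "(\<Sum>B\<in>Pow {1..n}. p H B i) = (\<Sum>B | B \<subseteq> {1..n} \<and> i \<in> B. c H B)"
      unfolding p_def by (intro sum.mono_neutral_cong_right) auto
    then show ?thesis using c[OF that(1)] that(2) by (simp add: coefficient_polytope_def)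
  qed
  have Max_p: "Max (p H B ` K) = (if B \<inter> K \<noteq> {} then c H B else 0)"
    if "H \<in> I" "B \<in> Pow {1..n}" "finite K" "K \<noteq> {}" for H B K
    using c_nonneg[of H B] that by (intro Max_eqI) (auto simp: p_def image_iff)
  have theta: "(\<Sum>B\<in>Pow {1..n}. Max (p H B ` K)) = theta n (c H) K"
    if "H \<in> I" "finite K" "K \<noteq> {}" for H K
    unfolding theta_def using that
    by (intro sum.mono_neutral_cong_right) (auto simp: Max_p)
  have V: "{1..n} \<noteq> {}" using n by auto
  have X: "finite (Pow {1..n})" "Pow {1..n} \<noteq> {}" by auto
  obtain d S s where d: "1 \<le> d" and S: "state_space d S" and s: "\<And>i. i \<in> {1..n} \<Longrightarrow> s i \<in> S"
    and disc: "\<And>K. finite K \<Longrightarrow> K \<noteq> {} \<Longrightarrow> K \<subseteq> {1..n} \<Longrightarrow>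
      discrimination S s K = Max ((\<lambda>H. \<Sum>B\<in>Pow {1..n}. Max (p H B ` K)) ` I)"
    using product_realization[OF I X V, of p] p_nonneg p_sum by metis
  have "error_profile S s K = F K" if K: "K \<in> I" for K
  proof -
    note K' = profile_indexD[OF K[unfolded I_def]]
    have "discrimination S s K = Max ((\<lambda>H. theta n (c H) K) ` I)"
      using disc[OF K'(2,3,1)] theta[OF _ K'(2,3)] by (simp cong: image_cong)
    also have "\<dots> = real (card K) - F K"
    proof (rule Max_eqI)
      show "finite ((\<lambda>H. theta n (c H) K) ` I)" using I by simp
      show "y \<le> real (card K) - F K" if "y \<in> (\<lambda>H. theta n (c H) K) ` I" for y
        using that extremal K by (fastforce simp: extremal_coefficients_def coeff_error_def I_def)
      have "theta n (c K) K = real (card K) - F K"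
        using extremal[OF K] by (simp add: extremal_coefficients_def coeff_error_def)
      then show "real (card K) - F K \<in> (\<lambda>H. theta n (c H) K) ` I" using K by force
    qed
    finally show ?thesis by (simp add: error_profile_def)
  qed
  then have "F = restrict (error_profile S s) (profile_index n)"
    using F unfolding I_def by (intro ext) (auto simp: PiE_iff extensional_def restrict_def)
  then show ?thesis using d S s unfolding gpt_region_def by blast
qed

lemma gpt_region_eq:
  assumes "2 \<le> n"
  shows "gpt_region n = {F \<in> profile_index n \<rightarrow>\<^sub>E UNIV. \<forall>H\<in>profile_index n.
    \<exists>c\<in>coefficient_polytope n. extremal_coefficients n F H c}"
proof -
  have "F \<in> profile_index n \<rightarrow>\<^sub>E UNIV" if "F \<in> gpt_region n" for F
    using that unfolding gpt_region_def by auto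
  then show ?thesis using gpt_region_necessary gpt_region_sufficient[OF assms] by blast
qed

section \<open>Rationality and boundedness of the region\<close>

text \<open>Every inequality that describes the region has this shape: one coordinate of the profile
  and an unweighted sum of coefficients, each with a rational factor.\<close>

lemma rational_system_coordinate:
  fixes q r b :: rat
  assumes "finite I" "K \<in> I" "finite C" "A \<subseteq> C"
  shows "rational_system I C (\<lambda>x c. of_rat q * x K + of_rat r * (\<Sum>k\<in>A. c k) \<le> of_rat b)"
proof -
  have "(\<Sum>i\<in>I. of_rat (if i = K then q else 0) * x i) = of_rat q * x K" for x :: "'a \<Rightarrow> real"
    using assms(1,2) by (simp add: if_distrib[of of_rat] if_distrib[of "\<lambda>y. y * _"] cong: if_cong)
  moreover have "(\<Sum>k\<in>C. of_rat (if k \<in> A then r else 0) * c k) = of_rat r * (\<Sum>k\<in>A. c k)"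
    for c :: "'b \<Rightarrow> real"
    unfolding sum_distrib_left using assms(3,4) by (intro sum.mono_neutral_cong_right) auto
  ultimately show ?thesis
    using rational_system_le[of I C "\<lambda>i. if i = K then q else 0" "\<lambda>k. if k \<in> A then r else 0" b]
    by simp
qed

text \<open>The condition for a fixed \<open>H\<close> is a linear system in the profile and the
  coefficients jointly; eliminating the coefficients projects it.\<close>

lemma rational_system_region:
  assumes H: "H \<in> profile_index n"
  shows "rational_system (profile_index n) {}
    (\<lambda>F (_ :: nat set \<Rightarrow> real). \<exists>c\<in>coefficient_polytope n. extremal_coefficients n F H c)"
proof -
  define C where "C = Pow {1..n} - {{}}"
  have finC: "finite C" by (simp add: C_def)
  note sys = rational_system_coordinate[OF finite_profile_index _ finC]
  \<comment> \<open>Constraints on the coefficients alone use coordinate \<open>H\<close> of the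
    profile with factor 0.\<close>
  have nonneg: "rational_system (profile_index n) C (\<lambda>F c. \<forall>B\<in>C. 0 \<le> c B)"
    using sys[OF H, of "{_}" 0 "-1" 0] finC by (intro rational_system_ball) simp_all
  have "rational_system (profile_index n) C
      (\<lambda>F c. (\<Sum>B | B \<subseteq> {1..n} \<and> i \<in> B. c B) \<le> 1 \<and> 1 \<le> (\<Sum>B | B \<subseteq> {1..n} \<and> i \<in> B. c B))" for i
    using sys[OF H, of "{B. B \<subseteq> {1..n} \<and> i \<in> B}" 0 1 1]
      sys[OF H, of "{B. B \<subseteq> {1..n} \<and> i \<in> B}" 0 "-1" "-1"]
    by (intro rational_system_conj) (auto simp: C_def of_rat_minus)
  then have sums: "rational_system (profile_index n) C
      (\<lambda>F c. \<forall>i\<in>{1..n}. (\<Sum>B | B \<subseteq> {1..n} \<and> i \<in> B. c B) = 1)"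
    unfolding order.antisym_conv2 eq_iff by (intro rational_system_ball) auto
  have le: "rational_system (profile_index n) C (\<lambda>F c. F K \<le> coeff_error n c K)"
    if "K \<in> profile_index n" for K
    using sys[OF that, of "{B. B \<subseteq> {1..n} \<and> B \<inter> K \<noteq> {}}" 1 1 "of_nat (card K)"]
    by (auto simp: C_def coeff_error_def theta_def algebra_simps)
  \<comment> \<open>Together with \<open>le\<close> at \<open>K = H\<close> this is the required
    equality.\<close>
  have ge: "rational_system (profile_index n) C (\<lambda>F c. coeff_error n c H \<le> F H)"
    using sys[OF H, of "{B. B \<subseteq> {1..n} \<and> B \<inter> H \<noteq> {}}" "-1" "-1" "- of_nat (card H)"]
    by (auto simp: C_def coeff_error_def theta_def algebra_simps of_rat_minus)
  define R where "R = (\<lambda>F c. (\<forall>B\<in>C. 0 \<le> c B) \<and>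
    (\<forall>i\<in>{1..n}. (\<Sum>B | B \<subseteq> {1..n} \<and> i \<in> B. c B) = 1) \<and>
    (\<forall>K\<in>profile_index n. F K \<le> coeff_error n c K) \<and> coeff_error n c H \<le> F H)"
  have "rational_system (profile_index n) C R"
    unfolding R_def
    by (intro rational_system_conj rational_system_ball nonneg sums le ge finite_profile_index)
  from rational_system_eliminate[OF finC this]
  have "rational_system (profile_index n) {} (\<lambda>F (_ :: nat set \<Rightarrow> real). \<exists>c. R F c)" .
  moreover have "(\<exists>c. R F c) \<longleftrightarrow> (\<exists>c\<in>coefficient_polytope n. extremal_coefficients n F H c)" for F
  proof
    assume "\<exists>c. R F c"
    then obtain c where c: "R F c" by blast
    \<comment> \<open>Elimination ranges over all functions, whereas the polytope consists of
      extensional ones; restricting to \<open>C\<close> leaves every relevant sum unchanged.\<close>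
    have "(\<Sum>B | B \<subseteq> {1..n} \<and> i \<in> B. restrict c C B) = (\<Sum>B | B \<subseteq> {1..n} \<and> i \<in> B. c B)" for i
      by (intro sum.cong) (auto simp: C_def)
    moreover have "restrict c C \<in> C \<rightarrow>\<^sub>E {0..}"
      using c unfolding R_def by (intro restrict_PiE_iff[THEN iffD2]) simp
    ultimately have "restrict c C \<in> coefficient_polytope n"
      using c unfolding coefficient_polytope_def R_def C_def[symmetric] by simp
    moreover have "theta n (restrict c C) K = theta n c K" for K
      unfolding theta_def by (intro sum.cong) (auto simp: C_def)
    then have "extremal_coefficients n F H (restrict c C)"
      using c H unfolding extremal_coefficients_def R_def coeff_error_def by (simp add: order.antisym)
    ultimately show "\<exists>c\<in>coefficient_polytope n. extremal_coefficients n F H c" by blast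
  next
    assume "\<exists>c\<in>coefficient_polytope n. extremal_coefficients n F H c"
    then obtain c where c: "c \<in> coefficient_polytope n" "extremal_coefficients n F H c" by blast
    have "c \<in> C \<rightarrow>\<^sub>E {0..}" using c(1) unfolding coefficient_polytope_def C_def by blast
    then have "\<forall>B\<in>C. 0 \<le> c B" by (simp add: PiE_iff)
    then have "R F c"
      using c unfolding coefficient_polytope_def extremal_coefficients_def R_def by simp
    then show "\<exists>c. R F c" by blast
  qed
  ultimately show ?thesis by simp
qed

text \<open>Each \<open>c B\<close> is a summand in the constraint at any \<open>i\<close> in
  \<open>B\<close>, hence at most 1, and there are at most \<open>2 ^ n\<close> sets.\<close>

lemma coeff_error_bound:
  assumes c: "c \<in> coefficient_polytope n" and K: "K \<subseteq> {1..n}"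
  shows "\<bar>coeff_error n c K\<bar> \<le> real n + 2 ^ n"
proof -
  have nonneg: "0 \<le> c B" if "B \<subseteq> {1..n}" "B \<noteq> {}" for B
    using c that unfolding coefficient_polytope_def by (force dest: PiE_mem[of _ _ _ B])
  have le_one: "c B \<le> 1" if B: "B \<subseteq> {1..n}" "B \<noteq> {}" for B
  proof -
    obtain i where i: "i \<in> B" using B by blast
    have "c B \<le> (\<Sum>B | B \<subseteq> {1..n} \<and> i \<in> B. c B)"
      using B i nonneg by (intro member_le_sum) auto
    also have "\<dots> = 1" using c i B unfolding coefficient_polytope_def by blast
    finally show ?thesis .
  qed
  have "theta n c K \<le> real (card {B. B \<subseteq> {1..n} \<and> B \<inter> K \<noteq> {}})"
    unfolding theta_def using le_one
    by (intro order.trans[OF sum_bounded_above[of _ _ 1]]) auto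
  also have "\<dots> \<le> real (card (Pow {1..n}))"
    by (intro of_nat_mono card_mono) auto
  finally have "theta n c K \<le> 2 ^ n" by (simp add: card_Pow)
  moreover have "0 \<le> theta n c K"
    unfolding theta_def using nonneg by (intro sum_nonneg) auto
  moreover have "card K \<le> n" using card_mono[OF _ K] by simp
  ultimately show ?thesis unfolding coeff_error_def by linarith
qed

lemma bounded_rational_polytope_gpt_region:
  assumes n: "2 \<le> n"
  shows "bounded_rational_polytope (profile_index n) (gpt_region n)"
proof -
  have "rational_system (profile_index n) {} (\<lambda>F (_ :: nat set \<Rightarrow> real). \<forall>H\<in>profile_index n.
      \<exists>c\<in>coefficient_polytope n. extremal_coefficients n F H c)"
    by (intro rational_system_ball finite_profile_index rational_system_region)
  from rational_system_polyhedron[OF this]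
  have "\<exists>L. finite L \<and> gpt_region n = {x \<in> profile_index n \<rightarrow>\<^sub>E UNIV. \<forall>(a, b)\<in>L.
      (\<Sum>i\<in>profile_index n. of_rat (a i) * x i) \<le> of_rat b}"
    unfolding gpt_region_eq[OF n] .
  \<comment> \<open>Taking \<open>H = K\<close> in the necessary condition makes \<open>F K\<close>
    equal to some \<open>coeff_error n c K\<close>.\<close>
  moreover have "\<bar>F K\<bar> \<le> real n + 2 ^ n" if "F \<in> gpt_region n" "K \<in> profile_index n" for F K
    using gpt_region_necessary[OF that] coeff_error_bound[OF _ profile_indexD(1)[OF that(2)]]
    unfolding extremal_coefficients_def by metis
  ultimately show ?thesis unfolding bounded_rational_polytope_def by blast
qed

theorem theorem4p3:
  fixes n :: nat
  assumes "2 \<le> n"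
  shows "(\<forall>F :: nat set \<Rightarrow> real. F {} = 0 \<and> (\<forall>i\<in>{1..n}. F {i} = 0) \<longrightarrow>
            (restrict F (profile_index n) \<in> gpt_region n \<longleftrightarrow>
             (\<forall>H. H \<subseteq> {1..n} \<and> 2 \<le> card H \<longrightarrow>
                (\<exists>c\<in>coefficient_polytope n.
                   (\<forall>K. K \<subseteq> {1..n} \<and> 2 \<le> card K \<longrightarrow> F K \<le> coeff_error n c K) \<and>
                   coeff_error n c H = F H))))
         \<and> bounded_rational_polytope (profile_index n) (gpt_region n)"
proof (intro conjI allI impI)
  fix F :: "nat set \<Rightarrow> real"
  show "restrict F (profile_index n) \<in> gpt_region n \<longleftrightarrow>
      (\<forall>H. H \<subseteq> {1..n} \<and> 2 \<le> card H \<longrightarrow> (\<exists>c\<in>coefficient_polytope n.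
        (\<forall>K. K \<subseteq> {1..n} \<and> 2 \<le> card K \<longrightarrow> F K \<le> coeff_error n c K) \<and> coeff_error n c H = F H))"
    unfolding gpt_region_eq[OF assms] extremal_coefficients_def
    by (simp add: profile_index_iff Ball_def)
qed (rule bounded_rational_polytope_gpt_region[OF assms])

end
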